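(* Let $N\geq 2$ be an integer and, for $j=1,\ldots,N$, let $F_j(s)=\sum_{n=1}^\infty a_j(n)n^{-s}$ be a Dirichlet series which is not identically zero and is absolutely convergent for $\sigma=\operatorname{Re}s>1$. If $\sum_{j=1}^N |a_j(1)|\neq 0$, then there exist infinitely many $\mathbf{c}=(c_1,\ldots,c_N)\in\mathbb{C}^N$ such that the Dirichlet series $L_{\mathbf{c}}(s)=\sum_{j=1}^N c_jF_j(s)$ has no zeros in some vertical strip $\sigma_1<\sigma<\sigma_2$ with $1<\sigma_1<\sigma_2<\sigma^*(L_{\mathbf{c}})$.
   Context: Write $s=\sigma+it$. For a Dirichlet series $L(s)$, $\sigma^*(L)$ denotes the least upper bound of the real parts of the zeros of $L(s)$ (in its half-plane of absolute convergence).
   Formalization: Adds the hypothesis that some two of the F_j are linearly independent on Re s > 1; without it the claim fails, e.g. for F_1 = … = F_N = 1, where every L_c is constant and so has either no zeros or zeros in every strip. *)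

theory Defs
  imports "HOL-Analysis.Analysis"
begin

text \<open>
  A Dirichlet series is given by its coefficient sequence. The coefficient of \<open>n\<^sup>-\<^sup>s\<close>
  is \<open>a n\<close> for \<open>n \<ge> 1\<close>; the value \<open>a 0\<close> is never used.
\<close>

definition dirichlet_term :: "(nat \<Rightarrow> complex) \<Rightarrow> complex \<Rightarrow> nat \<Rightarrow> complex" where
  "dirichlet_term a s n = a (Suc n) / of_nat (Suc n) powr s"

definition dirichlet_series :: "(nat \<Rightarrow> complex) \<Rightarrow> complex \<Rightarrow> complex" where
  "dirichlet_series a s = (\<Sum>n. dirichlet_term a s n)"

definition dirichlet_abs_conv :: "(nat \<Rightarrow> complex) \<Rightarrow> complex \<Rightarrow> bool" where
  "dirichlet_abs_conv a s \<longleftrightarrow> summable (\<lambda>n. norm (dirichlet_term a s n))"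

definition abs_conv_abscissa :: "(nat \<Rightarrow> complex) \<Rightarrow> ereal" where
  "abs_conv_abscissa a = Inf {ereal \<sigma> |\<sigma>. dirichlet_abs_conv a (of_real \<sigma>)}"

definition dirichlet_zeros :: "(nat \<Rightarrow> complex) \<Rightarrow> complex set" where
  "dirichlet_zeros a = {s. abs_conv_abscissa a < ereal (Re s) \<and> dirichlet_series a s = 0}"

text \<open>
  The supremum is taken in the extended reals, so it is \<open>- \<infinity>\<close> if there are no zeros
  and \<open>\<infinity>\<close> if the series vanishes identically.
\<close>

definition sigma_star :: "(nat \<Rightarrow> complex) \<Rightarrow> ereal" where
  "sigma_star a = (SUP s\<in>dirichlet_zeros a. ereal (Re s))"

definition lin_comb :: "complex ^ 'j \<Rightarrow> ('j::finite \<Rightarrow> nat \<Rightarrow> complex) \<Rightarrow> nat \<Rightarrow> complex" where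
  "lin_comb c a n = (\<Sum>j\<in>UNIV. c $ j * a j n)"

lemma dirichlet_series_lin_comb:
  assumes "\<And>j. dirichlet_abs_conv (a j) s"
  shows "dirichlet_series (lin_comb c a) s = (\<Sum>j\<in>UNIV. c $ j * dirichlet_series (a j) s)"
proof -
  have sm: "summable (dirichlet_term (a j) s)" for j
    using assms[of j] by (auto simp: dirichlet_abs_conv_def intro: summable_norm_cancel)
  have "dirichlet_series (lin_comb c a) s
      = (\<Sum>n. \<Sum>j\<in>UNIV. c $ j * dirichlet_term (a j) s n)"
    by (simp add: dirichlet_series_def dirichlet_term_def lin_comb_def sum_divide_distrib)
  also have "\<dots> = (\<Sum>j\<in>UNIV. \<Sum>n. c $ j * dirichlet_term (a j) s n)"
    by (rule suminf_sum) (intro summable_mult sm)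
  also have "\<dots> = (\<Sum>j\<in>UNIV. c $ j * dirichlet_series (a j) s)"
    by (simp add: dirichlet_series_def suminf_mult sm)
  finally show ?thesis .
qed

text \<open>
  Some two of the functions given by the series are linearly independent on \<open>Re s > 1\<close>.
  Without this every linear combination is a multiple of a single function, which need
  not have any zeros: take \<open>a j n = (if n = 1 then 1 else 0)\<close> for all \<open>j\<close>.
\<close>

definition not_all_proportional :: "('j \<Rightarrow> nat \<Rightarrow> complex) \<Rightarrow> bool" where
  "not_all_proportional a \<longleftrightarrow>
     (\<exists>j k. \<forall>\<alpha> \<beta>. (\<forall>s. Re s > 1 \<longrightarrow>
        \<alpha> * dirichlet_series (a j) s + \<beta> * dirichlet_series (a k) s = 0) \<longrightarrow> \<alpha> = 0 \<and> \<beta> = 0)"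

end

(*
  Pick k with a k 1 \<noteq> 0. By non-proportionality some combination L of the F j has vanishing
  constant coefficient but is not identically zero. Its first nonzero coefficient dominates far
  to the right, so L is bounded away from 0 on a strip there, and so is L + e * F k for all
  small e. Taking e = - L(x) / F k(x) with x real, the combination L + e * F k has the zero x,
  and e tends to 0 through nonzero values as x tends to infinity.
*)

theory Submission
  imports Defs
begin

section \<open>Estimates for absolutely convergent Dirichlet series in right half-planes\<close>

lemma norm_dirichlet_term:
  "norm (dirichlet_term a s n) = norm (a (Suc n)) * real (Suc n) powr (- Re s)"
proof -
  have "norm (of_nat (Suc n) powr s :: complex) = real (Suc n) powr Re s"
    by (simp add: norm_powr_real powr_def del: of_nat_Suc)
  then show ?thesis
    unfolding dirichlet_term_def norm_divide by (simp add: powr_minus divide_inverse)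
qed

lemma dirichlet_abs_conv_lin_comb:
  assumes "\<And>j. dirichlet_abs_conv (a j) s"
  shows "dirichlet_abs_conv (lin_comb c a) s"
  unfolding dirichlet_abs_conv_def
proof (rule summable_comparison_test')
  show "summable (\<lambda>n. \<Sum>j\<in>UNIV. norm (c $ j) * norm (dirichlet_term (a j) s n))"
    using assms unfolding dirichlet_abs_conv_def by (intro summable_sum summable_mult) auto
  show "norm (norm (dirichlet_term (lin_comb c a) s n))
      \<le> (\<Sum>j\<in>UNIV. norm (c $ j) * norm (dirichlet_term (a j) s n))" if "n \<ge> 0" for n
  proof -
    have "dirichlet_term (lin_comb c a) s n = (\<Sum>j\<in>UNIV. c $ j * dirichlet_term (a j) s n)"
      by (simp add: dirichlet_term_def lin_comb_def sum_divide_distrib)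
    then show ?thesis
      by (simp add: norm_mult[symmetric] norm_sum)
  qed
qed

text \<open>Comparing the remaining terms with those at \<open>\<sigma>0\<close> extracts a factor
  that is largest at the next base, \<open>m + 2\<close>. The constant \<open>C\<close> depends
  neither on \<open>s\<close> nor, in particular, on \<open>Im s\<close>.\<close>

lemma dirichlet_series_first_term:
  assumes conv: "dirichlet_abs_conv a (of_real \<sigma>0)"
    and zero: "\<And>n. n < m \<Longrightarrow> a (Suc n) = 0"
  obtains C where "\<And>s. Re s \<ge> \<sigma>0 \<Longrightarrow>
    norm (dirichlet_series a s - dirichlet_term a s m) \<le> C * real (m + 2) powr (- Re s)"
proof
  let ?D = "\<Sum>n. norm (dirichlet_term a (of_real \<sigma>0) n)"
  let ?C = "?D * real (m + 2) powr \<sigma>0"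
  fix s :: complex assume s: "Re s \<ge> \<sigma>0"
  define g where "g n = (if n = m then 0 else dirichlet_term a s n)" for n
  define q where "q = real (m + 2) powr (\<sigma>0 - Re s)"
  have sm0: "summable (\<lambda>n. norm (dirichlet_term a (of_real \<sigma>0) n))"
    using conv by (simp add: dirichlet_abs_conv_def)
  have bound: "norm (g n) \<le> norm (dirichlet_term a (of_real \<sigma>0) n) * q" for n
  proof (cases "n \<le> m")
    case True
    then have "g n = 0"
      using zero[of n] by (auto simp: g_def dirichlet_term_def)
    then show ?thesis by (simp add: q_def)
  next
    case False
    have "norm (g n) = norm (a (Suc n)) * (real (Suc n) powr (- \<sigma>0) * real (Suc n) powr (\<sigma>0 - Re s))"
      using False by (simp add: g_def norm_dirichlet_term flip: powr_add)
    \<comment> \<open>Here \<open>n > m\<close>, so \<open>Suc n\<close> is at least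
      \<open>m + 2\<close>, and the exponent \<open>\<sigma>0 - Re s\<close> is not
      positive.\<close>
    also have "\<dots> \<le> norm (a (Suc n)) * (real (Suc n) powr (- \<sigma>0) * q)"
      unfolding q_def using False s by (intro mult_left_mono powr_mono2') auto
    finally show ?thesis by (simp add: norm_dirichlet_term)
  qed
  have smg: "summable (\<lambda>n. norm (g n))"
    using bound by (intro summable_comparison_test'[OF summable_mult2[OF sm0, of q]]) auto
  have "g sums suminf g"
    using smg summable_norm_cancel by blast
  moreover have "(\<lambda>n. if n = m then dirichlet_term a s n else 0) sums dirichlet_term a s m"
    by (rule sums_single)
  ultimately have "(\<lambda>n. g n + (if n = m then dirichlet_term a s n else 0))
      sums (suminf g + dirichlet_term a s m)"
    by (rule sums_add)
  moreover have "(\<lambda>n. g n + (if n = m then dirichlet_term a s n else 0)) = dirichlet_term a s"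
    by (auto simp: g_def)
  ultimately have "dirichlet_series a s - dirichlet_term a s m = suminf g"
    by (simp add: dirichlet_series_def sums_iff)
  also have "norm (suminf g) \<le> (\<Sum>n. norm (dirichlet_term a (of_real \<sigma>0) n) * q)"
    using bound summable_norm[OF smg] suminf_le[OF _ smg summable_mult2[OF sm0, of q]] by force
  also have "\<dots> = ?D * q"
    using suminf_mult2[OF sm0] by simp
  also have "\<dots> = ?C * real (m + 2) powr (- Re s)"
    by (simp add: q_def flip: powr_add)
  finally show "norm (dirichlet_series a s - dirichlet_term a s m) \<le> ?C * real (m + 2) powr (- Re s)" .
qed

lemma powr_minus_tendsto_0:
  assumes "(r::real) > 1"
  shows "((\<lambda>x. r powr (- x)) \<longlongrightarrow> 0) at_top"
proof -
  have "LIM x at_top. x * ln r :> at_top"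
    using assms filterlim_at_top_mult_tendsto_pos[OF tendsto_const, of "ln r"] filterlim_ident
    by fastforce
  then have "LIM x at_top. - (x * ln r) :> at_bot"
    by (simp add: filterlim_uminus_at_bot)
  from filterlim_compose[OF exp_at_bot this] show ?thesis
    using assms by (simp add: powr_def)
qed

lemma tendsto_dirichlet_series_at_top:
  assumes "dirichlet_abs_conv a (of_real \<sigma>0)"
  shows "((\<lambda>x. dirichlet_series a (of_real x)) \<longlongrightarrow> a 1) at_top"
proof -
  obtain C where C: "\<And>s. Re s \<ge> \<sigma>0 \<Longrightarrow>
      norm (dirichlet_series a s - dirichlet_term a s 0) \<le> C * real (0 + 2) powr (- Re s)"
    using dirichlet_series_first_term[OF assms, of 0] by auto
  have "((\<lambda>x::real. 2 powr (- x)) \<longlongrightarrow> 0) at_top"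
    by (rule powr_minus_tendsto_0) simp
  then have "((\<lambda>x. C * 2 powr (- x)) \<longlongrightarrow> 0) at_top"
    by (rule tendsto_mult_right_zero)
  moreover have "\<forall>\<^sub>F x in at_top. norm (dirichlet_series a (of_real x) - a 1) \<le> C * 2 powr (- x)"
    using eventually_ge_at_top[of \<sigma>0]
  proof eventually_elim
    case (elim x)
    then show ?case using C[of "of_real x"] by (simp add: dirichlet_term_def)
  qed
  ultimately have "((\<lambda>x. dirichlet_series a (of_real x) - a 1) \<longlongrightarrow> 0) at_top"
    by (rule Lim_null_comparison[rotated])
  then show ?thesis by (rule LIM_zero_cancel)
qed

lemma bounded_dirichlet_series:
  assumes "dirichlet_abs_conv a (of_real \<sigma>0)"
  obtains K where "K > 0" "\<And>s. Re s \<ge> \<sigma>0 \<Longrightarrow> norm (dirichlet_series a s) \<le> K"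
proof
  let ?D = "\<Sum>n. norm (dirichlet_term a (of_real \<sigma>0) n)"
  have sm0: "summable (\<lambda>n. norm (dirichlet_term a (of_real \<sigma>0) n))"
    using assms by (simp add: dirichlet_abs_conv_def)
  \<comment> \<open>The summand 1 keeps the bound positive even if all terms vanish; the theorem
    divides by it.\<close>
  show "?D + 1 > 0"
    using suminf_nonneg[OF sm0] by simp
  fix s :: complex assume s: "Re s \<ge> \<sigma>0"
  have le: "norm (dirichlet_term a s n) \<le> norm (dirichlet_term a (of_real \<sigma>0) n)" for n
    unfolding norm_dirichlet_term using s by (intro mult_left_mono powr_mono) auto
  have "norm (dirichlet_series a s) \<le> ?D"
    unfolding dirichlet_series_def by (rule norm_suminf_le[OF le sm0])
  then show "norm (dirichlet_series a s) \<le> ?D + 1" by simp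
qed

text \<open>Nonvanishing at one point supplies a first nonzero coefficient,
  \<open>a (Suc m)\<close>. Relative to its term the remainder decays like
  \<open>r powr (- Re s)\<close> with \<open>r > 1\<close>, so it eventually takes away at most half
  of the leading term, uniformly in \<open>Im s\<close>.\<close>

lemma dirichlet_series_lower_bound:
  assumes conv: "dirichlet_abs_conv a (of_real \<sigma>0)"
    and nz: "dirichlet_series a s0 \<noteq> 0"
  obtains S m B where "S \<ge> \<sigma>0" "B > 0"
    "\<And>s. Re s \<ge> S \<Longrightarrow> norm (dirichlet_series a s) \<ge> B * real (Suc m) powr (- Re s)"
proof -
  have ex: "\<exists>n. a (Suc n) \<noteq> 0"
  proof (rule ccontr)
    assume "\<not> ?thesis"
    then have "dirichlet_term a s0 = (\<lambda>n. 0)"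
      by (auto simp: dirichlet_term_def)
    then show False using nz by (simp add: dirichlet_series_def)
  qed
  define m where "m = (LEAST n. a (Suc n) \<noteq> 0)"
  have am: "a (Suc m) \<noteq> 0" and min: "\<And>n. n < m \<Longrightarrow> a (Suc n) = 0"
    using LeastI_ex[OF ex] not_less_Least by (auto simp: m_def)
  obtain C where C: "\<And>s. Re s \<ge> \<sigma>0 \<Longrightarrow>
    norm (dirichlet_series a s - dirichlet_term a s m) \<le> C * real (m + 2) powr (- Re s)"
    using dirichlet_series_first_term[OF conv min] by blast
  define r where "r = real (m + 2) / real (Suc m)"
  have r: "r > 1" by (simp add: r_def)
  have "((\<lambda>x. C * r powr (- x)) \<longlongrightarrow> 0) at_top"
    using r by (intro tendsto_mult_right_zero powr_minus_tendsto_0)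
  then have "\<forall>\<^sub>F x in at_top. C * r powr (- x) < norm (a (Suc m)) / 2"
    using am by (intro order_tendstoD(2)) auto
  then obtain S0 where S0: "\<And>x. x \<ge> S0 \<Longrightarrow> C * r powr (- x) < norm (a (Suc m)) / 2"
    by (auto simp: eventually_at_top_linorder)
  show ?thesis
  proof
    show "max S0 \<sigma>0 \<ge> \<sigma>0" "norm (a (Suc m)) / 2 > 0" using am by auto
    fix s :: complex assume s: "Re s \<ge> max S0 \<sigma>0"
    let ?p = "real (Suc m) powr (- Re s)"
    have "C * real (m + 2) powr (- Re s) = C * r powr (- Re s) * ?p"
      by (simp add: r_def flip: powr_mult)
    also have "\<dots> \<le> norm (a (Suc m)) / 2 * ?p"
      using S0[of "Re s"] s by (intro mult_right_mono) auto
    finally have "norm (dirichlet_series a s - dirichlet_term a s m) \<le> norm (a (Suc m)) / 2 * ?p"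
      using C[of s] s by linarith
    moreover have "norm (dirichlet_term a s m) - norm (dirichlet_series a s)
        \<le> norm (dirichlet_series a s - dirichlet_term a s m)"
      by (metis norm_minus_commute norm_triangle_ineq2)
    ultimately show "norm (a (Suc m)) / 2 * ?p \<le> norm (dirichlet_series a s)"
      by (simp add: norm_dirichlet_term)
  qed
qed

section \<open>Zeros and linear combinations\<close>

lemma sigma_star_gt:
  assumes "\<And>s. Re s > 1 \<Longrightarrow> dirichlet_abs_conv a s"
    and "dirichlet_series a (of_real x) = 0" "1 < x" "y < x"
  shows "ereal y < sigma_star a"
proof -
  \<comment> \<open>A zero counts only strictly to the right of the abscissa of convergence;
    convergence at the intermediate point \<open>z\<close> puts that abscissa below
    \<open>x\<close>.\<close>
  obtain z where z: "1 < z" "z < x" using dense[OF \<open>1 < x\<close>] by blast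
  have "abs_conv_abscissa a \<le> ereal z"
    unfolding abs_conv_abscissa_def using assms(1)[of "of_real z"] z by (intro Inf_lower) auto
  then have "of_real x \<in> dirichlet_zeros a"
    using assms z by (auto simp: dirichlet_zeros_def intro: le_less_trans)
  then have "ereal x \<le> sigma_star a"
    unfolding sigma_star_def by (rule SUP_upper2) simp
  then show ?thesis using \<open>y < x\<close> by (simp add: less_le_trans[of _ "ereal x"])
qed

text \<open>The combinations \<open>a k 1 * F i - a i 1 * F k\<close> have constant coefficient 0.
  If all of them vanished identically, every series would be a multiple of the \<open>k\<close>-th
  one, so no two would be independent.\<close>

lemma not_all_proportional_combination:
  fixes a :: "'j::finite \<Rightarrow> nat \<Rightarrow> complex"
  assumes conv: "\<And>j s. Re s > 1 \<Longrightarrow> dirichlet_abs_conv (a j) s"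
    and np: "not_all_proportional a" and k: "a k 1 \<noteq> 0"
  obtains d s where "lin_comb d a 1 = 0" "Re s > 1" "dirichlet_series (lin_comb d a) s \<noteq> 0"
proof (rule ccontr)
  note witness = that
  assume "\<not> thesis"
  then have triv: "dirichlet_series (lin_comb d a) s = 0" if "lin_comb d a 1 = 0" "Re s > 1" for d s
    using that witness by blast
  have F: "a k 1 * dirichlet_series (a i) s = a i 1 * dirichlet_series (a k) s" if "Re s > 1" for i s
  proof -
    \<comment> \<open>Writing \<open>d\<close> as a difference of two indicators also covers
      \<open>i = k\<close>, where \<open>d\<close> is 0.\<close>
    define d :: "complex ^ 'j" where
      "d = (\<chi> j. (if j = i then a k 1 else 0) - (if j = k then a i 1 else 0))"
    have sum_d: "(\<Sum>j\<in>UNIV. d $ j * f j) = a k 1 * f i - a i 1 * f k" for f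
      by (simp add: d_def left_diff_distrib sum_subtractf if_distrib[of "\<lambda>x. x * _"] cong: if_cong)
    have "lin_comb d a 1 = 0" by (simp add: lin_comb_def sum_d)
    from triv[OF this that] show ?thesis
      using dirichlet_series_lin_comb[OF conv[OF that], of d] by (simp add: sum_d)
  qed
  obtain i j where indep: "\<And>\<alpha> \<beta>. (\<And>s. Re s > 1 \<Longrightarrow>
      \<alpha> * dirichlet_series (a i) s + \<beta> * dirichlet_series (a j) s = 0) \<Longrightarrow> \<alpha> = 0 \<and> \<beta> = 0"
    using np unfolding not_all_proportional_def by blast
  \<comment> \<open>Eliminating the \<open>k\<close>-th series between the relations for
    \<open>i\<close> and \<open>j\<close> gives a linear relation, whose coefficients must vanish by
    independence.\<close>
  have "a j 1 = 0 \<and> - a i 1 = 0"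
  proof (rule indep)
    fix s :: complex assume s: "Re s > 1"
    have "a k 1 * (a j 1 * dirichlet_series (a i) s + - a i 1 * dirichlet_series (a j) s) = 0"
      using F[OF s, of i] F[OF s, of j] by algebra
    then show "a j 1 * dirichlet_series (a i) s + - a i 1 * dirichlet_series (a j) s = 0"
      using k by simp
  qed
  \<comment> \<open>With \<open>a i 1 = 0\<close>, the relation \<open>F\<close> makes the
    \<open>i\<close>-th series vanish identically, so the coefficients 1 and 0 form a forbidden
    relation.\<close>
  then have "(1::complex) = 0 \<and> (0::complex) = 0"
    using F[of _ i] k by (intro indep) auto
  then show False by simp
qed

section \<open>Perturbing a combination with vanishing constant coefficient\<close>

theorem theorem1:
  fixes a :: "'j::finite \<Rightarrow> nat \<Rightarrow> complex"
  assumes "CARD('j) \<ge> 2"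
    and "\<And>j s. Re s > 1 \<Longrightarrow> dirichlet_abs_conv (a j) s"
    and "\<And>j. \<exists>s. Re s > 1 \<and> dirichlet_series (a j) s \<noteq> 0"
    and "(\<Sum>j\<in>UNIV. norm (a j 1)) \<noteq> 0"
    and "not_all_proportional a"
  shows "infinite {c :: complex ^ 'j. \<exists>\<sigma>1 \<sigma>2 :: real.
           1 < \<sigma>1 \<and> \<sigma>1 < \<sigma>2 \<and> ereal \<sigma>2 < sigma_star (lin_comb c a) \<and>
           (\<forall>s. \<sigma>1 < Re s \<and> Re s < \<sigma>2 \<longrightarrow> dirichlet_series (lin_comb c a) s \<noteq> 0)}"
    (is "infinite ?A")
proof
  assume fin: "finite ?A"
  note conv = assms(2)
  obtain k where k: "a k 1 \<noteq> 0"
    using assms(4) by fastforce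
  obtain d s0 where d: "lin_comb d a 1 = 0" "dirichlet_series (lin_comb d a) s0 \<noteq> 0"
    using not_all_proportional_combination[of a k] conv assms(5) k by metis
  define L where "L = dirichlet_series (lin_comb d a)"
  define F where "F = dirichlet_series (a k)"
  have convL: "dirichlet_abs_conv (lin_comb c a) s" if "Re s > 1" for c s
    using dirichlet_abs_conv_lin_comb conv that by blast
  have "dirichlet_abs_conv (lin_comb d a) (of_real 2)"
    by (rule convL) simp
  note low_L = dirichlet_series_lower_bound[OF this d(2), folded L_def]
  obtain S m B where S: "S \<ge> 2" and B: "B > 0"
    and low: "\<And>s. Re s \<ge> S \<Longrightarrow> norm (L s) \<ge> B * real (Suc m) powr (- Re s)"
    by (rule low_L) blast
  obtain K where K: "K > 0" "\<And>s. Re s \<ge> 2 \<Longrightarrow> norm (F s) \<le> K"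
    using bounded_dirichlet_series[of "a k" 2] conv[of "of_real 2"] unfolding F_def by auto
  \<comment> \<open>This is the lower bound for \<open>norm (L s)\<close> at the right edge of the
    strip from \<open>S\<close> to \<open>S + 1\<close>, where it is weakest.\<close>
  define \<delta> where "\<delta> = B * real (Suc m) powr (- (S + 1))"
  have \<delta>: "\<delta> > 0" using B by (simp add: \<delta>_def)
  define c where "c e = d + axis k e" for e
  have series_c: "dirichlet_series (lin_comb (c e) a) s = L s + e * F s" if "Re s > 1" for e s
    unfolding L_def F_def c_def using that
    by (simp add: dirichlet_series_lin_comb conv distrib_right sum.distrib axis_def if_distribR
        if_distrib[of "\<lambda>x. x * _"] cong: if_cong)
  \<comment> \<open>This choice makes \<open>L + e x * F\<close> vanish at \<open>x\<close> once
    \<open>F\<close> is nonzero there. It tends to 0 because \<open>L\<close> tends to its constant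
    coefficient 0 and \<open>F\<close> to \<open>a k 1\<close>, which is nonzero.\<close>
  define e where "e x = - L (of_real x) / F (of_real x)" for x
  have limF: "((\<lambda>x. F (of_real x)) \<longlongrightarrow> a k 1) at_top"
    unfolding F_def using conv[of "of_real 2"] by (intro tendsto_dirichlet_series_at_top[of _ 2]) auto
  have "((\<lambda>x. L (of_real x)) \<longlongrightarrow> 0) at_top"
    using tendsto_dirichlet_series_at_top[of "lin_comb d a" 2] convL[of "of_real 2"] d
    unfolding L_def by auto
  then have lim_e: "(e \<longlongrightarrow> 0) at_top"
    unfolding e_def using tendsto_divide[OF tendsto_minus limF] k by force
  have F_nz: "\<forall>\<^sub>F x in at_top. F (of_real x) \<noteq> 0"
    using tendsto_imp_eventually_ne[OF limF k] .
  have small: "\<forall>\<^sub>F x in at_top. norm (e x) < \<delta> / K"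
    using order_tendstoD(2)[OF tendsto_norm_zero[OF lim_e]] \<delta> K by simp
  have good: "\<forall>\<^sub>F x in at_top. c (e x) \<in> ?A \<and> e x \<noteq> 0"
    \<comment> \<open>The first condition puts the zero \<open>x\<close> to the right of the strip;
      the last keeps the perturbation below \<open>\<delta>\<close> on it.\<close>
    using eventually_gt_at_top[of "S + 1"] F_nz small
  proof eventually_elim
    case (elim x)
    have "norm (L (of_real x)) > 0"
      by (rule less_le_trans[OF _ low]) (use elim B in auto)
    then have "e x \<noteq> 0" using elim by (simp add: e_def)
    have "ereal (S + 1) < sigma_star (lin_comb (c (e x)) a)"
      by (rule sigma_star_gt[of _ x])
        (use elim S in \<open>auto simp: convL series_c e_def\<close>)
    moreover have "dirichlet_series (lin_comb (c (e x)) a) s \<noteq> 0" if s: "S < Re s" "Re s < S + 1" for s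
    proof
      assume "dirichlet_series (lin_comb (c (e x)) a) s = 0"
      then have "L s = - (e x * F s)"
        using series_c[of s] s S by (simp add: eq_neg_iff_add_eq_0)
      then have "norm (L s) \<le> norm (e x) * K"
        using K(2)[of s] s S by (simp add: norm_mult mult_left_mono)
      also have "\<dots> < \<delta>" using elim K by (simp add: field_simps)
      also have "\<delta> \<le> B * real (Suc m) powr (- Re s)"
        unfolding \<delta>_def using s B by (intro mult_left_mono powr_mono) auto
      also have "\<dots> \<le> norm (L s)" using low s by simp
      finally show False by simp
    qed
    ultimately show ?case
      using S \<open>e x \<noteq> 0\<close> by (intro conjI CollectI exI[of _ S] exI[of _ "S + 1"]) auto
  qed
  have "inj c" by (auto simp: inj_def c_def axis_eq_axis)
  then have "finite (c -` ?A)" using fin by (rule finite_vimageI[rotated])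
  \<comment> \<open>Finitely many parameters other than 0 form a closed set missing 0. As
    \<open>e x\<close> tends to 0 it eventually leaves this set, whereas \<open>good\<close> keeps
    it inside.\<close>
  then have "open (- (c -` ?A - {0}))" by (intro open_Compl finite_imp_closed) auto
  then have "\<forall>\<^sub>F x in at_top. e x \<in> - (c -` ?A - {0})"
    using lim_e by (auto simp: tendsto_def)
  with good have "\<forall>\<^sub>F x :: real in at_top. False"
    by eventually_elim auto
  then show False by simp
qed

end
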